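(* Let $n\ge1$, $p\in(0,1)$, $q=1-p$, and let $\pi\in S_n$ with $d=\operatorname{des}(\pi)$, $a=\operatorname{asc}(\pi)$ and $v=\operatorname{vl}(\pi)$. Let $$F_{\pi}(u) := \sum_{B\in \mathcal{B}(\pi)}u^{|B|}\,p^{|\operatorname{Asc}(\pi)\cap B|}\,q^{|\operatorname{Des}(\pi)\cap B|}.$$ Then $$F_\pi(u) = (1+pu)^{a-v}(1+qu)^{d-v}(1+u)^v .$$
   Context: For $\pi=(\pi_1,\ldots,\pi_n)\in S_n$ and $[n-1]=\{1,\ldots,n-1\}$: $\operatorname{Des}(\pi)=\{i\in[n-1]:\pi_i>\pi_{i+1}\}$, $\operatorname{Asc}(\pi)=[n-1]\setminus\operatorname{Des}(\pi)$, $\operatorname{Vl}(\pi)=\{2\le i\le n-1:\pi_{i-1}>\pi_i<\pi_{i+1}\}$; $\operatorname{des}(\pi),\operatorname{asc}(\pi),\operatorname{vl}(\pi)$ are the cardinalities of these sets. Moreover $$\mathcal{B}(\pi)=\{B\subseteq [n-1]: \forall j \in \operatorname{Vl}(\pi),\ \{j-1, j\}\not\subseteq B\}.$$ *)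

theory Defs
  imports Complex_Main "HOL-Combinatorics.Permutations"
begin

(* An element of S_n is a function \<pi> :: nat => nat with \<pi> permutes {1..n}; its one-line
   notation is (\<pi> 1, ..., \<pi> n). The size n is not determined by the function (permutes only
   says that \<pi> is the identity outside {1..n}), so it is an explicit argument below. *)

definition Des :: "nat \<Rightarrow> (nat \<Rightarrow> nat) \<Rightarrow> nat set" where
  "Des n \<pi> = {i \<in> {1..n - 1}. \<pi> i > \<pi> (i + 1)}"

definition Asc :: "nat \<Rightarrow> (nat \<Rightarrow> nat) \<Rightarrow> nat set" where
  "Asc n \<pi> = {1..n - 1} - Des n \<pi>"

definition Vl :: "nat \<Rightarrow> (nat \<Rightarrow> nat) \<Rightarrow> nat set" where
  "Vl n \<pi> = {i \<in> {2..n - 1}. \<pi> (i - 1) > \<pi> i \<and> \<pi> i < \<pi> (i + 1)}"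

definition des :: "nat \<Rightarrow> (nat \<Rightarrow> nat) \<Rightarrow> nat" where
  "des n \<pi> = card (Des n \<pi>)"

definition asc :: "nat \<Rightarrow> (nat \<Rightarrow> nat) \<Rightarrow> nat" where
  "asc n \<pi> = card (Asc n \<pi>)"

definition vl :: "nat \<Rightarrow> (nat \<Rightarrow> nat) \<Rightarrow> nat" where
  "vl n \<pi> = card (Vl n \<pi>)"

definition BB :: "nat \<Rightarrow> (nat \<Rightarrow> nat) \<Rightarrow> nat set set" where
  "BB n \<pi> = {B. B \<subseteq> {1..n - 1} \<and> (\<forall>j \<in> Vl n \<pi>. \<not> {j - 1, j} \<subseteq> B)}"

(* The indeterminate u ranges over an arbitrary real field, in particular over the reals and
   over the complex numbers; the real parameters p, q are embedded by of_real. *)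
definition F :: "nat \<Rightarrow> (nat \<Rightarrow> nat) \<Rightarrow> real \<Rightarrow> real \<Rightarrow> 'a::real_field \<Rightarrow> 'a" where
  "F n \<pi> p q u =
     (\<Sum>B \<in> BB n \<pi>. u ^ card B * of_real p ^ card (Asc n \<pi> \<inter> B) * of_real q ^ card (Des n \<pi> \<inter> B))"

end

theory Submission
  imports Defs
begin

text \<open>
  Weigh a position \<open>i\<close> by \<open>p * u\<close> if it is an ascent and by \<open>q * u\<close> if it is a descent. Then
  \<open>F\<close> is the sum, over the admissible \<open>B\<close>, of the product of the weights in \<open>B\<close>.
  A valley \<open>j\<close> is exactly a descent \<open>j - 1\<close> followed by an ascent \<open>j\<close>, so the forbidden
  pairs \<open>{j - 1, j}\<close> are pairwise disjoint, and the choice of \<open>B\<close> splits into independent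
  choices: in or out for each position outside the pairs, and anything but the full
  pair at each valley. Hence the sum factorises (\<open>sum_prod_avoiding_pairs\<close>). A position outside the
  pairs contributes \<open>1 + p * u\<close> or \<open>1 + q * u\<close>, and a pair contributes
  \<open>1 + p * u + q * u = 1 + u\<close>; since each pair uses up one ascent and one descent,
  \<open>a - v\<close> ascents and \<open>d - v\<close> descents remain.
\<close>

lemma sum_prod_Pow:
  fixes w :: "'b \<Rightarrow> 'a::comm_semiring_1"
  assumes "finite X"
  shows "(\<Sum>B \<in> Pow X. \<Prod>i\<in>B. w i) = (\<Prod>i\<in>X. 1 + w i)"
  using prod_add[OF assms, of w "\<lambda>_. 1"] by (simp add: add.commute)

text \<open>
  The pairs \<open>{f j, j}\<close> are removed from \<open>X\<close> one at a time; the hypotheses say that they are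
  disjoint two-element subsets of \<open>X\<close>, so that removing one leaves the constraints at the
  others intact.
\<close>

lemma sum_prod_avoiding_pairs:
  fixes w :: "'b \<Rightarrow> 'a::comm_semiring_1"
  assumes "finite V" and "finite X" and "V \<subseteq> X" and "f ` V \<subseteq> X"
    and "inj_on f V" and "V \<inter> f ` V = {}"
  shows "(\<Sum>B | B \<subseteq> X \<and> (\<forall>j\<in>V. \<not> {f j, j} \<subseteq> B). \<Prod>i\<in>B. w i) =
    (\<Prod>i \<in> X - (V \<union> f ` V). 1 + w i) * (\<Prod>j\<in>V. 1 + w j + w (f j))"
  using assms
proof (induction V arbitrary: X rule: finite_induct)
  case empty
  then show ?case using sum_prod_Pow[of X w] by (simp add: Pow_def)
next
  case (insert j V)
  define Y where "Y = X - {j, f j}"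
  define adm where "adm = {B. B \<subseteq> Y \<and> (\<forall>j\<in>V. \<not> {f j, j} \<subseteq> B)}"
  define E where "E = {{}, {j}, {f j}}"
  have ne: "j \<noteq> f j" using insert.prems by auto
  have fj: "f k \<noteq> f j" if "k \<in> V" for k
    using that insert.hyps insert.prems(4) by (auto simp: inj_on_def)
  have V: "V \<subseteq> Y" "f ` V \<subseteq> Y" "V \<inter> f ` V = {}" "inj_on f V" "finite Y"
    using insert.hyps insert.prems fj by (auto simp: Y_def)
  have IH: "(\<Sum>B\<in>adm. \<Prod>i\<in>B. w i) =
      (\<Prod>i \<in> Y - (V \<union> f ` V). 1 + w i) * (\<Prod>j\<in>V. 1 + w j + w (f j))"
    unfolding adm_def by (rule insert.IH) (use V in auto)
  have Y: "Y - (V \<union> f ` V) = X - (insert j V \<union> f ` insert j V)"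
    by (auto simp: Y_def)
  have fadm: "C \<subseteq> Y" "finite C" "j \<notin> C" "f j \<notin> C" if "C \<in> adm" for C
    using that V(5) by (auto simp: adm_def Y_def intro: finite_subset)
  \<comment> \<open>A set avoiding all pairs amounts to an admissible set \<open>C\<close> away from \<open>{j, f j}\<close> together
    with one of the three proper subsets of that pair; these three choices produce the factor
    \<open>1 + w j + w (f j)\<close>.\<close>
  have "(\<Sum>B | B \<subseteq> X \<and> (\<forall>k\<in>insert j V. \<not> {f k, k} \<subseteq> B). \<Prod>i\<in>B. w i) =
      (\<Sum>(C, e)\<in>adm \<times> E. \<Prod>i\<in>C \<union> e. w i)"
  proof (rule sum.reindex_bij_witness[where i = "\<lambda>(C, e). C \<union> e"
        and j = "\<lambda>B. (B - {j, f j}, B \<inter> {j, f j})"])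
    fix B assume "B \<in> {B. B \<subseteq> X \<and> (\<forall>k\<in>insert j V. \<not> {f k, k} \<subseteq> B)}"
    then have B: "B \<subseteq> X" "\<not> {f j, j} \<subseteq> B" "\<forall>k\<in>V. \<not> {f k, k} \<subseteq> B" by auto
    have "B \<inter> {j, f j} \<in> E" using B(2) by (auto simp: E_def)
    moreover have "B - {j, f j} \<in> adm" using B by (auto simp: adm_def Y_def)
    ultimately show "(B - {j, f j}, B \<inter> {j, f j}) \<in> adm \<times> E" by simp
    have "B - {j, f j} \<union> B \<inter> {j, f j} = B" by auto
    then show "(case (B - {j, f j}, B \<inter> {j, f j}) of (C, e) \<Rightarrow> C \<union> e) = B"
      and "(case (B - {j, f j}, B \<inter> {j, f j}) of (C, e) \<Rightarrow> \<Prod>i\<in>C \<union> e. w i) = (\<Prod>i\<in>B. w i)"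
      by simp_all
  next
    fix P assume "P \<in> adm \<times> E"
    then obtain C e where P: "P = (C, e)" "C \<in> adm" "e \<in> E" by auto
    note C = fadm[OF P(2)]
    show "(\<lambda>B. (B - {j, f j}, B \<inter> {j, f j})) (case P of (C, e) \<Rightarrow> C \<union> e) = P"
      using P(1,3) C ne by (auto simp: E_def)
    have e: "e \<subseteq> {j, f j}" "\<not> {f j, j} \<subseteq> e" using P(3) ne by (auto simp: E_def)
    have "C \<union> e \<subseteq> X" using C(1) e(1) insert.prems by (auto simp: Y_def)
    moreover have "\<not> {f j, j} \<subseteq> C \<union> e" using e(2) C by blast
    moreover have "\<not> {f k, k} \<subseteq> C \<union> e" if "k \<in> V" for k
    proof -
      have "f k \<in> Y" "k \<in> Y" using that V by auto
      then have "f k \<notin> e" "k \<notin> e" using e(1) by (auto simp: Y_def)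
      then show ?thesis using P(2) that by (auto simp: adm_def)
    qed
    ultimately show "(case P of (C, e) \<Rightarrow> C \<union> e)
        \<in> {B. B \<subseteq> X \<and> (\<forall>k\<in>insert j V. \<not> {f k, k} \<subseteq> B)}"
      unfolding P(1) prod.case by blast
  qed
  also have "\<dots> = (\<Sum>C\<in>adm. \<Sum>e\<in>E. \<Prod>i\<in>C \<union> e. w i)"
    by (simp add: sum.cartesian_product)
  also have "\<dots> = (\<Sum>C\<in>adm. (\<Prod>i\<in>C. w i) * (1 + w j + w (f j)))"
    by (rule sum.cong) (use fadm ne in \<open>auto simp: E_def algebra_simps\<close>)
  also have "\<dots> = (\<Sum>C\<in>adm. \<Prod>i\<in>C. w i) * (1 + w j + w (f j))"
    by (simp add: sum_distrib_right)
  finally show ?case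
    unfolding IH Y using insert.hyps by (simp add: mult_ac)
qed

lemma Vl_subset_Asc: "Vl n \<pi> \<subseteq> Asc n \<pi>"
  by (auto simp: Vl_def Asc_def Des_def)

lemma pred_Vl_subset_Des: "(\<lambda>j. j - 1) ` Vl n \<pi> \<subseteq> Des n \<pi>"
  by (auto simp: Vl_def Des_def)

lemma inj_on_pred_Vl: "inj_on (\<lambda>j. j - 1) (Vl n \<pi>)"
  by (auto simp: Vl_def intro!: inj_onI)

lemma F_as_weighted_sum:
  "F n \<pi> p q u =
    (\<Sum>B \<in> BB n \<pi>. \<Prod>i\<in>B. (if i \<in> Asc n \<pi> then of_real p else of_real q) * u)"
  unfolding F_def
proof (rule sum.cong[OF refl])
  fix B assume "B \<in> BB n \<pi>"
  then have B: "B \<subseteq> {1..n - 1}" by (simp add: BB_def)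
  then have fin: "finite B" by (rule finite_subset) simp
  have "B \<inter> {i. i \<in> Asc n \<pi>} = Asc n \<pi> \<inter> B" "B \<inter> - {i. i \<in> Asc n \<pi>} = Des n \<pi> \<inter> B"
    using B by (auto simp: Asc_def Des_def)
  then show "u ^ card B * of_real p ^ card (Asc n \<pi> \<inter> B) * of_real q ^ card (Des n \<pi> \<inter> B) =
      (\<Prod>i\<in>B. (if i \<in> Asc n \<pi> then of_real p else of_real q) * u)"
    using fin by (simp add: prod.distrib prod.If_cases)
qed

theorem proposition1p3:
  fixes n d a v :: nat and p q :: real and \<pi> :: "nat \<Rightarrow> nat" and u :: "'a::real_field"
  assumes "n \<ge> 1" and "0 < p" and "p < 1" and "q = 1 - p"
    and "\<pi> permutes {1..n}"
    and "d = des n \<pi>" and "a = asc n \<pi>" and "v = vl n \<pi>"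
  shows "F n \<pi> p q u =
    (1 + of_real p * u) ^ (a - v) * (1 + of_real q * u) ^ (d - v) * (1 + u) ^ v"
proof -
  let ?A = "Asc n \<pi>" and ?D = "Des n \<pi>" and ?V = "Vl n \<pi>"
  let ?f = "\<lambda>j::nat. j - 1" and ?X = "{1..n - 1}"
  define w :: "nat \<Rightarrow> 'a" where
    "w i = (if i \<in> ?A then of_real p else of_real q) * u" for i
  have AD: "?A \<inter> ?D = {}" "?A \<union> ?D = ?X" by (auto simp: Asc_def Des_def)
  have fin: "finite ?A" "finite ?D" using AD(2) by (metis finite_Un finite_atLeastAtMost)+
  have finV: "finite ?V" using Vl_subset_Asc fin(1) by (rule finite_subset)
  note sub = Vl_subset_Asc[of n \<pi>] pred_Vl_subset_Des[of n \<pi>]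
  have rest: "?X - (?V \<union> ?f ` ?V) = (?A - ?V) \<union> (?D - ?f ` ?V)"
    using AD sub by blast
  have "F n \<pi> p q u = (\<Sum>B | B \<subseteq> ?X \<and> (\<forall>j\<in>?V. \<not> {?f j, j} \<subseteq> B). \<Prod>i\<in>B. w i)"
    by (simp add: F_as_weighted_sum BB_def w_def)
  also have "\<dots> = (\<Prod>i \<in> ?X - (?V \<union> ?f ` ?V). 1 + w i) * (\<Prod>j\<in>?V. 1 + w j + w (?f j))"
    by (rule sum_prod_avoiding_pairs) (use finV inj_on_pred_Vl AD sub in \<open>blast+ | simp\<close>)+
  also have "(\<Prod>i \<in> ?X - (?V \<union> ?f ` ?V). 1 + w i) =
      (\<Prod>i \<in> ?A - ?V. 1 + w i) * (\<Prod>i \<in> ?D - ?f ` ?V. 1 + w i)"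
    unfolding rest by (rule prod.union_disjoint) (use fin AD in auto)
  also have "(\<Prod>i \<in> ?A - ?V. 1 + w i) = (1 + of_real p * u) ^ (a - v)"
    using finV sub(1) assms(7,8) by (simp add: w_def asc_def vl_def card_Diff_subset)
  also have "(\<Prod>i \<in> ?D - ?f ` ?V. 1 + w i) = (1 + of_real q * u) ^ (d - v)"
  proof -
    have "(\<Prod>i \<in> ?D - ?f ` ?V. 1 + w i) = (\<Prod>i \<in> ?D - ?f ` ?V. 1 + of_real q * u)"
      by (rule prod.cong) (use AD(1) in \<open>auto simp: w_def\<close>)
    moreover have "card (?D - ?f ` ?V) = d - v"
      using card_Diff_subset[OF finite_imageI[OF finV] sub(2)] card_image[OF inj_on_pred_Vl, of n \<pi>]
        assms(6,8) by (simp add: des_def vl_def)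
    ultimately show ?thesis by simp
  qed
  also have "(\<Prod>j\<in>?V. 1 + w j + w (?f j)) = (\<Prod>j\<in>?V. 1 + u)"
  proof (rule prod.cong[OF refl])
    fix j assume "j \<in> ?V"
    then have "j \<in> ?A" "?f j \<notin> ?A" using sub AD(1) by blast+
    then have "w j + w (?f j) = of_real (p + q) * u"
      by (simp add: w_def algebra_simps)
    then show "1 + w j + w (?f j) = 1 + u"
      using assms(4) by (simp add: add.assoc)
  qed
  also have "\<dots> = (1 + u) ^ v" using assms(8) by (simp add: vl_def)
  finally show ?thesis .
qed

end
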